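(* Let $P(x_{1},\dots,x_{n})\in\mathbb{Z}[x_{1},\dots,x_{n}]$ be a polynomial with constant term $0$ whose variables are exactly $x_{1},\dots,x_{n}$, and suppose that $P$ can be factorized as $$P(x_{1},\dots,x_{n})=\prod_{i=1}^{k}Q_{i}(x_{1},\dots,x_{n}),$$ where each $Q_{i}$ is a polynomial with integer coefficients whose set of variables is a subset of $\{x_{1},\dots,x_{n}\}$. If $P$ is partition regular on $\mathbb{N}$, then there exists an index $i\in\{1,\dots,k\}$ such that $Q_{i}$ is partition regular on $\mathbb{N}$.
   Context: Here $\mathbb{N}=\{1,2,3,\dots\}$. A polynomial $P(x_{1},\dots,x_{n})$ with integer coefficients is partition regular on $\mathbb{N}$ if, for every finite coloration $\mathbb{N}=A_{1}\cup\dots\cup A_{r}$ of $\mathbb{N}$, the equation $P(x_{1},\dots,x_{n})=0$ has a monochromatic solution, i.e. there are an index $j\leq r$ and elements $a_{1},\dots,a_{n}\in A_{j}$ (not required to be distinct) with $P(a_{1},\dots,a_{n})=0$. *)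

theory Defs
  imports "HOL-Library.Poly_Mapping"
begin

(* Integer polynomials in variables indexed by nat: a polynomial maps each monomial to its
   coefficient, a monomial maps each variable to its exponent.  The ring operations are those of
   Poly_Mapping, where multiplication is convolution over the additive monoid of monomials. *)
type_synonym int_mpoly = "(nat \<Rightarrow>\<^sub>0 nat) \<Rightarrow>\<^sub>0 int"

definition vars :: "int_mpoly \<Rightarrow> nat set" where
  "vars P = (\<Union>m\<in>Poly_Mapping.keys P. Poly_Mapping.keys m)"

definition const_term :: "int_mpoly \<Rightarrow> int" where
  "const_term P = Poly_Mapping.lookup P 0"

definition eval_mpoly :: "(nat \<Rightarrow> int) \<Rightarrow> int_mpoly \<Rightarrow> int" where
  "eval_mpoly a P =
     (\<Sum>m\<in>Poly_Mapping.keys P.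
        Poly_Mapping.lookup P m * (\<Prod>v\<in>Poly_Mapping.keys m. a v ^ Poly_Mapping.lookup m v))"

(* The positive integers are the set {1..} of nat.  As in the equality N = A_1 \<union> ... \<union> A_r,
   the colour classes are neither required to be disjoint nor nonempty. *)
definition finite_colouring :: "nat \<Rightarrow> (nat \<Rightarrow> nat set) \<Rightarrow> bool" where
  "finite_colouring r A \<longleftrightarrow> (\<Union>j\<in>{1..r}. A j) = {1..}"

(* P is read as a polynomial in x_1, ..., x_n, so this is meant for vars P \<subseteq> {1..n}: the
   values of a outside {1..n} are unconstrained. *)
definition partition_regular :: "nat \<Rightarrow> int_mpoly \<Rightarrow> bool" where
  "partition_regular n P \<longleftrightarrow>
     (\<forall>r A. finite_colouring r A \<longrightarrow>
        (\<exists>j\<in>{1..r}. \<exists>a :: nat \<Rightarrow> nat.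
           (\<forall>i\<in>{1..n}. a i \<in> A j) \<and> eval_mpoly (\<lambda>i. int (a i)) P = 0))"

end

theory Submission
  imports Defs
begin

text \<open>Argue by contraposition. If neither of two factors is partition regular, each has a
  finite colouring without monochromatic zeros. In the common refinement of the two, a monochromatic
  point is monochromatic for both, so neither factor vanishes there; since evaluation is
  multiplicative and the integers have no zero divisors, the product does not vanish either
  (\<open>partition_regular_multD\<close>, resting on \<open>eval_mpoly_mult\<close>). Induction on
  the number of factors finishes, and the empty product is excluded because the constant 1 has no
  zeros.\<close>

definition eval_monom :: "(nat \<Rightarrow> int) \<Rightarrow> (nat \<Rightarrow>\<^sub>0 nat) \<Rightarrow> int" where
  "eval_monom a m = (\<Prod>v\<in>Poly_Mapping.keys m. a v ^ Poly_Mapping.lookup m v)"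

text \<open>Variables outside the support contribute a factor 1. Monomials with different supports
  can thus be compared over one common index set.\<close>

lemma eval_monom_superset:
  assumes "finite S" "Poly_Mapping.keys m \<subseteq> S"
  shows "eval_monom a m = (\<Prod>v\<in>S. a v ^ Poly_Mapping.lookup m v)"
  unfolding eval_monom_def
  by (rule prod.mono_neutral_left) (use assms in \<open>auto simp: in_keys_iff\<close>)

lemma eval_monom_zero [simp]: "eval_monom a 0 = 1"
  by (simp add: eval_monom_def)

lemma eval_monom_add: "eval_monom a (m + m') = eval_monom a m * eval_monom a m'"
proof -
  let ?S = "Poly_Mapping.keys m \<union> Poly_Mapping.keys m'"
  have "Poly_Mapping.keys (m + m') \<subseteq> ?S" by (rule Poly_Mapping.keys_add)
  then show ?thesis
    by (simp add: eval_monom_superset[of ?S] lookup_add power_add prod.distrib)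
qed

lemma eval_mpoly_superset:
  assumes "finite S" "Poly_Mapping.keys P \<subseteq> S"
  shows "eval_mpoly a P = (\<Sum>m\<in>S. Poly_Mapping.lookup P m * eval_monom a m)"
  unfolding eval_mpoly_def eval_monom_def
  by (rule sum.mono_neutral_left) (use assms in \<open>auto simp: in_keys_iff\<close>)

lemma eval_mpoly_zero [simp]: "eval_mpoly a 0 = 0"
  by (simp add: eval_mpoly_def)

lemma eval_mpoly_single [simp]:
  "eval_mpoly a (Poly_Mapping.single m c) = c * eval_monom a m"
  by (simp add: eval_mpoly_superset[of "{m}"])

lemma eval_mpoly_one [simp]: "eval_mpoly a 1 = 1"
  using eval_mpoly_single[of a 0 1] by simp

lemma eval_mpoly_add: "eval_mpoly a (P + Q) = eval_mpoly a P + eval_mpoly a Q"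
proof -
  let ?S = "Poly_Mapping.keys P \<union> Poly_Mapping.keys Q"
  have "Poly_Mapping.keys (P + Q) \<subseteq> ?S" by (rule Poly_Mapping.keys_add)
  then show ?thesis
    by (simp add: eval_mpoly_superset[of ?S] lookup_add distrib_right sum.distrib)
qed

text \<open>Every polynomial is a finite sum of single terms. Phrasing the step with
  \<open>+\<close> rather than \<open>update\<close> makes distributivity and additivity of
  evaluation applicable.\<close>

lemma mpoly_induct [case_names zero single_add]:
  fixes P :: "'a \<Rightarrow>\<^sub>0 'b::monoid_add"
  assumes "R 0" and "\<And>m c P. R P \<Longrightarrow> R (Poly_Mapping.single m c + P)"
  shows "R P"
proof (induction P rule: update_induct)
  case const
  show ?case by (rule assms(1))
next
  case (update P m c)
  \<comment> \<open>By \<open>update(1)\<close>, \<open>m\<close> is not a key of \<open>P\<close>,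
    so the old coefficient is 0 and overwriting agrees with adding.\<close>
  have "Poly_Mapping.update m c P = Poly_Mapping.single m c + P"
    using update(1) by (intro poly_mapping_eqI)
      (auto simp: lookup_add lookup_update lookup_single in_keys_iff when_def)
  then show ?case using assms(2)[OF update(3)] by simp
qed

text \<open>Induction on \<open>Q\<close> reduces the convolution to a product of two single terms,
  where exponents add and \<open>eval_monom_add\<close> applies.\<close>

lemma eval_mpoly_single_mult:
  "eval_mpoly a (Poly_Mapping.single m c * Q) = c * eval_monom a m * eval_mpoly a Q"
  by (induction Q rule: mpoly_induct)
    (simp_all add: distrib_left eval_mpoly_add mult_single eval_monom_add)

lemma eval_mpoly_mult: "eval_mpoly a (P * Q) = eval_mpoly a P * eval_mpoly a Q"
  by (induction P rule: mpoly_induct)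
    (simp_all add: distrib_right eval_mpoly_add eval_mpoly_single_mult)

text \<open>Covers the empty product. The colouring with a single class already refutes
  regularity.\<close>

lemma not_partition_regular_one: "\<not> partition_regular n 1"
proof -
  have "finite_colouring 1 (\<lambda>_. {1..})" by (simp add: finite_colouring_def)
  then show ?thesis by (auto simp: partition_regular_def)
qed

lemma partition_regular_multD:
  assumes "partition_regular n (P * Q)"
  shows "partition_regular n P \<or> partition_regular n Q"
proof (rule ccontr)
  assume "\<not> ?thesis"
  then obtain r A s B
    where A: "finite_colouring r A" 
      and nP: "\<And>j a. j \<in> {1..r} \<Longrightarrow> \<forall>i\<in>{1..n}. a i \<in> A j \<Longrightarrow> eval_mpoly (\<lambda>i. int (a i)) P \<noteq> 0"
      and B: "finite_colouring s B" 
      and nQ: "\<And>j a. j \<in> {1..s} \<Longrightarrow> \<forall>i\<in>{1..n}. a i \<in> B j \<Longrightarrow> eval_mpoly (\<lambda>i. int (a i)) Q \<noteq> 0"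
    unfolding partition_regular_def by metis
  \<comment> \<open>Colours must be numbered from 1, so pairs of colours are encoded by the numbers
    up to \<open>r * s\<close>. Some cells of the refinement may be empty, which a colouring
    permits.\<close>
  obtain f where f: "bij_betw f {1..r * s} ({1..r} \<times> {1..s})"
    using finite_same_card_bij[of "{1..r * s}" "{1..r} \<times> {1..s}"]
    by (auto simp: card_cartesian_product)
  have f_in: "fst (f j) \<in> {1..r}" "snd (f j) \<in> {1..s}" if "j \<in> {1..r * s}" for j
    using bij_betwE[OF f] that by (auto simp: mem_Times_iff)
  let ?C = "\<lambda>j. A (fst (f j)) \<inter> B (snd (f j))"
  have "(\<Union>j\<in>{1..r * s}. ?C j) = (\<Union>p\<in>f ` {1..r * s}. A (fst p) \<inter> B (snd p))"
    by (simp add: image_image)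
  also have "\<dots> = (\<Union>j\<in>{1..r}. A j) \<inter> (\<Union>j\<in>{1..s}. B j)"
    unfolding bij_betw_imp_surj_on[OF f] by fastforce
  also have "\<dots> = {1..}"
    using A B unfolding finite_colouring_def by simp
  finally have "finite_colouring (r * s) ?C"
    by (simp only: finite_colouring_def)
  with assms obtain j a where j: "j \<in> {1..r * s}" and a: "\<forall>i\<in>{1..n}. a i \<in> ?C j"
    and "eval_mpoly (\<lambda>i. int (a i)) (P * Q) = 0"
    unfolding partition_regular_def by blast
  \<comment> \<open>The integers form a domain, so one factor vanishes at \<open>a\<close>, whose
    relevant coordinates lie in one class of \<open>A\<close> and in one class of
    \<open>B\<close>.\<close>
  then have "eval_mpoly (\<lambda>i. int (a i)) P = 0 \<or> eval_mpoly (\<lambda>i. int (a i)) Q = 0"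
    by (simp add: eval_mpoly_mult)
  then show False
    using nP[OF f_in(1)[OF j]] nQ[OF f_in(2)[OF j]] a by blast
qed

lemma partition_regular_prodD:
  assumes "finite I" "partition_regular n (\<Prod>i\<in>I. Q i)"
  shows "\<exists>i\<in>I. partition_regular n (Q i)"
  using assms
  by (induction I rule: finite_induct)
    (auto simp: not_partition_regular_one dest: partition_regular_multD)

theorem theorem3p8:
  fixes n k :: nat and P :: int_mpoly and Q :: "nat \<Rightarrow> int_mpoly"
  assumes "const_term P = 0"
    and "vars P = {1..n}"
    and "\<And>i. i \<in> {1..k} \<Longrightarrow> vars (Q i) \<subseteq> {1..n}"
    and "P = (\<Prod>i=1..k. Q i)"
    and "partition_regular n P"
  shows "\<exists>i\<in>{1..k}. partition_regular n (Q i)"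
  using partition_regular_prodD[of "{1..k}" n Q] assms(4,5) by simp

end
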